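(* Let $f:[a,b]\times\mathbb R\to\mathbb R$ be continuous and Lipschitz continuous in its second argument, i.e. there is a constant $L$ with $|f(t,u_1)-f(t,u_2)|\le L|u_1-u_2|$ for all $t\in[a,b]$, $u_1,u_2\in\mathbb R$, and let $u$ be the solution of $u'=f(t,u)$ on $[a,b]$, $u(a)=u_0$. Let $a_{21},b_1,b_2,c_2$ be real coefficients satisfying $$b_1+b_2=1,\qquad a_{21}=c_2,\qquad b_2c_2=\tfrac12.$$ Suppose that the squared shape parameters $\epsilon_n^2\in\mathbb R$ are bounded for all $n=0,1,\dots,N-1$ (by a bound independent of $n$ and of $h$). Then the two-stage RBF Runge-Kutta method defined in the context is convergent: with $h=(b-a)/N$, $v_N\to u(b)$ as $h\to0$ (equivalently $N\to\infty$).
   Context: For $N\ge1$ let $h=(b-a)/N$ and $t_n=a+nh$, $n=0,\dots,N$. The two-stage RBF Runge-Kutta method with squared shape parameters $\epsilon_n^2\in\mathbb R$ (the shape parameters are real or purely imaginary; they may vary with $n$ and $h$) produces $v_0=u_0$ and, for $n=0,\dots,N-1$, $$v_{n+1}=v_n+h(b_1k_1+b_2k_2),\quad k_1=f(t_n,v_n),\quad k_2=f\big(t_n+c_2h,\;v_ne^{-\epsilon_n^2(a_{21}h)^2}+h\,a_{21}k_1\big).$$ It is understood that $f$ is defined (and has the stated properties) at all the arguments occurring in the method. *)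

theory Defs
  imports "HOL-Analysis.Analysis"
begin

text \<open>
  The parameter \<open>e2\<close> is the squared shape parameter itself: as a shape parameter may be
  real or purely imaginary, its square ranges over all real numbers.
\<close>

definition rbf_rk2_step ::
  "(real \<Rightarrow> real \<Rightarrow> real) \<Rightarrow> real \<Rightarrow> real \<Rightarrow> real \<Rightarrow> real \<Rightarrow> real \<Rightarrow> real \<Rightarrow> real \<Rightarrow> real \<Rightarrow> real"
where
  "rbf_rk2_step f a21 b1 b2 c2 h e2 t v =
     (let k1 = f t v;
          k2 = f (t + c2 * h) (v * exp (- (e2 * (a21 * h)\<^sup>2)) + h * a21 * k1)
      in v + h * (b1 * k1 + b2 * k2))"

primrec rbf_rk2 ::
  "(real \<Rightarrow> real \<Rightarrow> real) \<Rightarrow> real \<Rightarrow> real \<Rightarrow> real \<Rightarrow> real \<Rightarrow> real \<Rightarrow> (nat \<Rightarrow> real) \<Rightarrow> real \<Rightarrow> real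
    \<Rightarrow> nat \<Rightarrow> real"
where
  "rbf_rk2 f a21 b1 b2 c2 h e2 a u0 0 = u0"
| "rbf_rk2 f a21 b1 b2 c2 h e2 a u0 (Suc n) =
     rbf_rk2_step f a21 b1 b2 c2 h (e2 n) (a + real n * h) (rbf_rk2 f a21 b1 b2 c2 h e2 a u0 n)"

end

theory Submission imports Defs begin

text \<open>
  Convergence is consistency plus stability. Write \<open>F\<close> for the exact slope
  \<open>f (t\<^sub>n) (u (t\<^sub>n))\<close>. As the weights add up to one, a step of the method differs from the
  Euler step \<open>u (t\<^sub>n) + h * F\<close> only through the deviations of the two stages from \<open>F\<close>. The
  Lipschitz condition bounds these by a multiple of the current error plus a remainder, in which the
  Gaussian factor \<open>exp (- (e2 * (a21 * h)\<^sup>2))\<close> is harmless: it tends to one uniformly in the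
  step number because the squared shape parameters are bounded (\<open>rbf_rk2_step_error\<close>,
  \<open>abs_exp_minus_one_le\<close>). By the mean value theorem the solution itself differs from its Euler
  step by \<open>h\<close> times an oscillation of \<open>u'\<close>. Hence the errors satisfy
  \<open>E (n + 1) \<le> (1 + h * C) * E n + h * \<eta>\<close> with \<open>C\<close> fixed and \<open>\<eta>\<close> arbitrarily small for small
  \<open>h\<close>, and a discrete Gronwall inequality gives \<open>E N \<le> exp (C * (b - a)) * (b - a) * \<eta>\<close>.

  Only continuity of \<open>f\<close> is available, so no order of convergence is obtained, and the smallness of
  the remainders comes from compactness. The abscissae \<open>t\<^sub>n + c2 * h\<close> may lie outside \<open>{a..b}\<close>,
  in a set \<open>T\<close> that need be neither closed nor bounded; the required uniformity therefore holds
  between points of \<open>{a..b}\<close> and nearby points of \<open>T\<close> (\<open>uniform_continuity_at_compact\<close>).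
\<close>

section \<open>Uniform continuity near a compact set\<close>

text \<open>
  A counterexample would consist of points \<open>s n \<in> T\<close> and \<open>t n \<in> K\<close> with vanishing distance;
  along a subsequence both converge to the same point of \<open>K\<close>, where joint continuity of \<open>f\<close> forces
  the two values to have the same limit. Closeness is measured from a point of \<open>K\<close> to an arbitrary
  point of \<open>T\<close>, so that abscissae slightly outside the interval of integration are covered.
\<close>

lemma uniform_continuity_at_compact:
  fixes f :: "'a::metric_space \<Rightarrow> 'b::topological_space \<Rightarrow> 'c::metric_space"
  assumes K: "compact K" "K \<subseteq> T"
    and f: "continuous_on (T \<times> UNIV) (\<lambda>(t, x). f t x)"
    and u: "continuous_on K u"
    and e: "0 < e"
  obtains d where "0 < d"
    and "\<And>s t. s \<in> T \<Longrightarrow> t \<in> K \<Longrightarrow> dist s t < d \<Longrightarrow> dist (f s (u t)) (f t (u t)) < e"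
proof -
  have "\<exists>d>0. \<forall>s\<in>T. \<forall>t\<in>K. dist s t < d \<longrightarrow> dist (f s (u t)) (f t (u t)) < e"
  proof (rule ccontr)
    assume neg: "\<not> ?thesis"
    have "\<exists>s t. s \<in> T \<and> t \<in> K \<and> dist s t < inverse (real (Suc n))
            \<and> e \<le> dist (f s (u t)) (f t (u t))" for n
    proof -
      have "0 < inverse (real (Suc n))"
        by simp
      with neg show ?thesis
        by (meson not_le)
    qed
    then obtain s t where st: "\<And>n. s n \<in> T" "\<And>n. t n \<in> K"
        "\<And>n. dist (s n) (t n) < inverse (real (Suc n))"
        "\<And>n. e \<le> dist (f (s n) (u (t n))) (f (t n) (u (t n)))"
      by metis
    obtain l r where l: "l \<in> K" and r: "strict_mono r" and tl: "(t \<circ> r) \<longlonglongrightarrow> l"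
      using K(1) st(2) unfolding compact_def by metis
    have "(\<lambda>n. dist (s n) (t n)) \<longlonglongrightarrow> 0"
    proof (rule tendsto_sandwich[OF _ _ tendsto_const LIMSEQ_inverse_real_of_nat])
      show "\<forall>\<^sub>F n in sequentially. dist (s n) (t n) \<le> inverse (real (Suc n))"
        using st(3) by (intro always_eventually allI less_imp_le)
    qed simp
    then have "((\<lambda>n. dist (s n) (t n)) \<circ> r) \<longlonglongrightarrow> 0"
      using r by (rule LIMSEQ_subseq_LIMSEQ)
    then have d0: "(\<lambda>n. dist (s (r n)) (t (r n))) \<longlonglongrightarrow> 0"
      by (simp add: o_def)
    have t: "(\<lambda>n. t (r n)) \<longlonglongrightarrow> l"
      using tl by (simp add: o_def)
    have s: "(\<lambda>n. s (r n)) \<longlonglongrightarrow> l"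
    proof (subst tendsto_dist_iff, rule tendsto_sandwich[OF _ _ tendsto_const])
      show "(\<lambda>n. dist (s (r n)) (t (r n)) + dist (t (r n)) l) \<longlonglongrightarrow> 0"
        using tendsto_add[OF d0 t[unfolded tendsto_dist_iff[of _ l]]] by simp
      show "\<forall>\<^sub>F n in sequentially. dist (s (r n)) l
          \<le> dist (s (r n)) (t (r n)) + dist (t (r n)) l"
        by (intro always_eventually allI dist_triangle)
    qed simp
    have ut: "(\<lambda>n. u (t (r n))) \<longlonglongrightarrow> u l"
      using continuous_on_tendsto_compose[OF u t l] st(2) by simp
    have lim: "(\<lambda>n. f (x n) (u (t (r n)))) \<longlonglongrightarrow> f l (u l)"
      if "x \<longlonglongrightarrow> l" "\<And>n. x n \<in> T" for x
      using continuous_on_tendsto_compose[OF f tendsto_Pair[OF that(1) ut]] that(2) l K(2)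
      by auto
    have "(\<lambda>n. dist (f (s (r n)) (u (t (r n)))) (f (t (r n)) (u (t (r n))))) \<longlonglongrightarrow> 0"
      using tendsto_dist[OF lim[OF s] lim[OF t]] st(1,2) K(2) by (auto simp: subset_iff)
    from order_tendstoD(2)[OF this e] show False
      using st(4) by (auto simp: eventually_sequentially not_less[symmetric])
  qed
  then show thesis
    using that by blast
qed

section \<open>Propagation of errors\<close>

text \<open>
  Discrete Gronwall inequality: since \<open>1 + h * C \<le> exp (C * h)\<close>, a step multiplies the bound by
  at most \<open>exp (C * h)\<close>, and the perturbation is absorbed because this factor is at least one.
\<close>

lemma discrete_gronwall:
  fixes E :: "nat \<Rightarrow> real"
  assumes "E 0 \<le> 0" "0 \<le> h" "0 \<le> C" "0 \<le> \<eta>"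
    and step: "\<And>n. n < N \<Longrightarrow> E (Suc n) \<le> (1 + h * C) * E n + h * \<eta>"
  shows "n \<le> N \<Longrightarrow> E n \<le> exp (C * (real n * h)) * (real n * h) * \<eta>"
proof (induction n)
  case 0
  show ?case
    using assms(1) by simp
next
  case (Suc n)
  define X where "X = exp (C * (real n * h))"
  have 1: "1 + h * C \<le> exp (C * h)"
    using exp_ge_add_one_self[of "C * h"] by (simp add: mult.commute)
  have split: "exp (C * (real (Suc n) * h)) = exp (C * h) * X"
    unfolding X_def by (simp add: exp_add[symmetric] algebra_simps)
  have ge1: "1 \<le> exp (C * (real (Suc n) * h))"
    using assms by simp
  have "E (Suc n) \<le> (1 + h * C) * E n + h * \<eta>"
    using Suc.prems by (intro step) simp
  also have "\<dots> \<le> (1 + h * C) * (X * (real n * h) * \<eta>) + h * \<eta>"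
    using Suc assms by (intro add_right_mono mult_left_mono) (simp_all add: X_def)
  also have "\<dots> \<le> exp (C * h) * (X * (real n * h) * \<eta>)
      + exp (C * (real (Suc n) * h)) * (h * \<eta>)"
    using assms 1 mult_right_mono[OF ge1, of "h * \<eta>"]
    by (intro add_mono mult_right_mono) (simp_all add: X_def)
  also have "\<dots> = exp (C * (real (Suc n) * h)) * (real (Suc n) * h) * \<eta>"
    unfolding split by (simp add: algebra_simps)
  finally show ?case .
qed

section \<open>Stability and consistency of one step\<close>

lemma abs_exp_minus_one_le:
  fixes y z :: real
  assumes "\<bar>y\<bar> \<le> z"
  shows "\<bar>exp y - 1\<bar> \<le> exp z - 1"
proof -
  have "exp y \<le> exp z" "1 + y \<le> exp y" "1 + z \<le> exp z"
    using assms by (auto intro: exp_ge_add_one_self)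
  with assms show ?thesis
    unfolding abs_le_iff by linarith
qed

text \<open>
  One step started at \<open>v\<close> is compared with the Euler step started at \<open>w\<close>, which is meant to be the
  exact solution at time \<open>t\<close>. Here \<open>\<delta>\<close> measures how far the Gaussian factor is from one, and \<open>\<rho>\<close>
  how much \<open>f\<close> varies between the two abscissae. Requiring \<open>h \<le> 1\<close> and \<open>\<delta> \<le> 1\<close> makes the
  amplification constant independent of \<open>h\<close> and of the shape parameter.
\<close>

lemma rbf_rk2_step_error:
  fixes f :: "real \<Rightarrow> real \<Rightarrow> real"
  assumes lip: "\<And>s x y. s \<in> {t, t + c2 * h} \<Longrightarrow> \<bar>f s x - f s y\<bar> \<le> L * \<bar>x - y\<bar>"
    and L: "0 \<le> L" and h: "0 \<le> h" "h \<le> 1" and b: "b1 + b2 = 1"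
    and M: "\<bar>w\<bar> \<le> M" "\<bar>f t w\<bar> \<le> M"
    and \<delta>: "\<bar>exp (- (e2 * (a21 * h)\<^sup>2)) - 1\<bar> \<le> \<delta>" "\<delta> \<le> 1"
    and \<rho>: "\<bar>f (t + c2 * h) w - f t w\<bar> \<le> \<rho>"
  shows "\<bar>rbf_rk2_step f a21 b1 b2 c2 h e2 t v - (w + h * f t w)\<bar>
    \<le> (1 + h * (\<bar>b1\<bar> * L + \<bar>b2\<bar> * (L * (2 + \<bar>a21\<bar> * L)))) * \<bar>v - w\<bar>
      + h * (\<bar>b2\<bar> * (\<rho> + L * (\<delta> + h * \<bar>a21\<bar>) * M))"
proof -
  define g where "g = exp (- (e2 * (a21 * h)\<^sup>2))"
  define k1 where "k1 = f t v"
  define y where "y = v * g + h * a21 * k1"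
  define k2 where "k2 = f (t + c2 * h) y"
  define F where "F = f t w"
  define e where "e = \<bar>v - w\<bar>"
  have e0: "0 \<le> e" and M0: "0 \<le> M"
    using M by (auto simp: e_def)
  have g: "\<bar>g - 1\<bar> \<le> \<delta>" "\<bar>g\<bar> \<le> 2"
    using \<delta> unfolding g_def by (auto simp: abs_le_iff)
  have k1: "\<bar>k1 - F\<bar> \<le> L * e"
    unfolding k1_def F_def e_def by (intro lip) simp
  have "y - w = (v - w) * g + w * (g - 1) + (h * a21) * (k1 - F) + (h * a21) * F"
    unfolding y_def by (simp add: algebra_simps)
  then have "\<bar>y - w\<bar> \<le> \<bar>v - w\<bar> * \<bar>g\<bar> + \<bar>w\<bar> * \<bar>g - 1\<bar>
      + \<bar>h * a21\<bar> * \<bar>k1 - F\<bar> + \<bar>h * a21\<bar> * \<bar>F\<bar>"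
    unfolding abs_mult[symmetric] by linarith
  also have "\<dots> \<le> e * 2 + M * \<delta> + \<bar>a21\<bar> * (L * e) + (h * \<bar>a21\<bar>) * M"
    using g k1 M M0 h e0 L
    by (intro add_mono mult_mono)
       (auto simp: e_def F_def abs_mult intro: mult_left_le_one_le)
  finally have y: "\<bar>y - w\<bar> \<le> (2 + \<bar>a21\<bar> * L) * e + (\<delta> + h * \<bar>a21\<bar>) * M"
    by (simp add: algebra_simps)
  have "\<bar>k2 - F\<bar> \<le> \<bar>k2 - f (t + c2 * h) w\<bar> + \<bar>f (t + c2 * h) w - F\<bar>"
    by linarith
  also have "\<dots> \<le> L * \<bar>y - w\<bar> + \<rho>"
    unfolding k2_def F_def by (intro add_mono lip \<rho>) simp
  also have "\<dots> \<le> L * ((2 + \<bar>a21\<bar> * L) * e + (\<delta> + h * \<bar>a21\<bar>) * M) + \<rho>"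
    using y L by (intro add_right_mono mult_left_mono)
  finally have k2: "\<bar>k2 - F\<bar>
      \<le> L * ((2 + \<bar>a21\<bar> * L) * e + (\<delta> + h * \<bar>a21\<bar>) * M) + \<rho>" .
  have "rbf_rk2_step f a21 b1 b2 c2 h e2 t v - (w + h * F)
      = (v - w) + h * (b1 * k1 + b2 * k2 - (b1 + b2) * F)"
    unfolding rbf_rk2_step_def Let_def k2_def y_def k1_def g_def b by (simp add: algebra_simps)
  also have "\<dots> = (v - w) + h * (b1 * (k1 - F) + b2 * (k2 - F))"
    by (simp add: algebra_simps)
  also have "\<bar>\<dots>\<bar> \<le> e + h * (\<bar>b1\<bar> * \<bar>k1 - F\<bar> + \<bar>b2\<bar> * \<bar>k2 - F\<bar>)"
  proof -
    have "\<bar>b1 * (k1 - F) + b2 * (k2 - F)\<bar> \<le> \<bar>b1\<bar> * \<bar>k1 - F\<bar> + \<bar>b2\<bar> * \<bar>k2 - F\<bar>"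
      unfolding abs_mult[symmetric] by linarith
    then have "\<bar>h * (b1 * (k1 - F) + b2 * (k2 - F))\<bar>
        \<le> h * (\<bar>b1\<bar> * \<bar>k1 - F\<bar> + \<bar>b2\<bar> * \<bar>k2 - F\<bar>)"
      using h by (simp add: abs_mult mult_left_mono)
    then show ?thesis
      unfolding e_def by linarith
  qed
  also have "\<dots> \<le> e + h * (\<bar>b1\<bar> * (L * e)
      + \<bar>b2\<bar> * (L * ((2 + \<bar>a21\<bar> * L) * e + (\<delta> + h * \<bar>a21\<bar>) * M) + \<rho>))"
    using k1 k2 h by (intro add_left_mono mult_left_mono add_mono) auto
  also have "\<dots> = (1 + h * (\<bar>b1\<bar> * L + \<bar>b2\<bar> * (L * (2 + \<bar>a21\<bar> * L)))) * e
      + h * (\<bar>b2\<bar> * (\<rho> + L * (\<delta> + h * \<bar>a21\<bar>) * M))"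
    by (simp add: algebra_simps)
  finally show ?thesis
    unfolding e_def F_def .
qed

section \<open>Convergence\<close>

theorem theorem4p1:
  fixes f :: "real \<Rightarrow> real \<Rightarrow> real" and u :: "real \<Rightarrow> real"
    and a b u0 L a21 b1 b2 c2 :: real
    and T :: "real set"
    and eps2 :: "nat \<Rightarrow> nat \<Rightarrow> real"
  assumes "a < b"
    and "{a..b} \<subseteq> T"
    and "\<And>N n. n < N \<Longrightarrow> a + real n * ((b - a) / real N) + c2 * ((b - a) / real N) \<in> T"
    and "continuous_on (T \<times> UNIV) (\<lambda>(t, x). f t x)"
    and "\<And>t x y. t \<in> T \<Longrightarrow> \<bar>f t x - f t y\<bar> \<le> L * \<bar>x - y\<bar>"
    and "\<And>t. t \<in> {a..b} \<Longrightarrow> (u has_real_derivative f t (u t)) (at t within {a..b})"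
    and "u a = u0"
    and "b1 + b2 = 1" and "a21 = c2" and "b2 * c2 = 1 / 2"
    and "\<exists>B. \<forall>N n. n < N \<longrightarrow> \<bar>eps2 N n\<bar> \<le> B"
  shows "(\<lambda>N. rbf_rk2 f a21 b1 b2 c2 ((b - a) / real N) (eps2 N) a u0 N) \<longlonglongrightarrow> u b"
proof -
  let ?h = "\<lambda>N. (b - a) / real N"
  let ?v = "\<lambda>N. rbf_rk2 f a21 b1 b2 c2 (?h N) (eps2 N) a u0"
  let ?u' = "\<lambda>t. f t (u t)"
  have lip: "\<And>t x y. t \<in> T \<Longrightarrow> \<bar>f t x - f t y\<bar> \<le> L * \<bar>x - y\<bar>"
    by (fact assms(5))
  have "a \<in> T"
    using assms(1,2) by auto
  from lip[OF this, of 1 0] have L: "0 \<le> L"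
    by simp
  have u: "continuous_on {a..b} u"
    using assms(6) by (rule DERIV_continuous_on)
  have u': "continuous_on {a..b} ?u'"
  proof -
    have "continuous_on {a..b} (\<lambda>t. (t, u t))"
      by (intro continuous_intros u)
    from continuous_on_compose2[OF assms(4) this] show ?thesis
      using assms(2) by auto
  qed
  have "bounded (u ` {a..b})" "bounded (?u' ` {a..b})"
    using u u' by (auto intro!: compact_imp_bounded compact_continuous_image)
  then obtain M1 M2 where "\<forall>t\<in>{a..b}. \<bar>u t\<bar> \<le> M1" "\<forall>t\<in>{a..b}. \<bar>?u' t\<bar> \<le> M2"
    by (auto simp: bounded_iff)
  then obtain M where M: "\<And>t. t \<in> {a..b} \<Longrightarrow> \<bar>u t\<bar> \<le> M \<and> \<bar>?u' t\<bar> \<le> M"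
    by (metis max.coboundedI1 max.coboundedI2)
  have M0: "0 \<le> M"
    using M[of a] assms(1) by auto
  obtain B where B: "\<And>N n. n < N \<Longrightarrow> \<bar>eps2 N n\<bar> \<le> B"
    using assms(11) by blast
  let ?\<delta> = "\<lambda>N. exp (B * (a21 * ?h N)\<^sup>2) - 1"
  have h0: "?h \<longlonglongrightarrow> 0"
    by (rule lim_const_over_n)
  have \<delta>0: "?\<delta> \<longlonglongrightarrow> 0"
    by (rule tendsto_eq_intros h0 refl | simp)+
  define C where "C = \<bar>b1\<bar> * L + \<bar>b2\<bar> * (L * (2 + \<bar>a21\<bar> * L))"
  \<comment> \<open>\<open>A * \<rho>\<close> is the perturbation per unit step when all small quantities are at most \<open>\<rho>\<close>:
    the summand one is the Euler defect of \<open>u\<close>, the other one the remainder of the second stage.\<close>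
  define A where "A = 1 + \<bar>b2\<bar> * (1 + 2 * L * M)"
  define K where "K = exp (C * (b - a)) * (b - a) * A"
  have C: "0 \<le> C" and A: "0 < A"
    using L M0 by (auto simp: C_def A_def intro!: add_pos_nonneg)
  have K: "0 < K"
    using A assms(1) by (simp add: K_def)
  show ?thesis
  proof (rule LIMSEQ_I)
    fix \<epsilon> :: real
    assume \<epsilon>: "0 < \<epsilon>"
    \<comment> \<open>The tolerance is chosen such that the final error bound \<open>K * \<rho>\<close> equals \<open>\<epsilon> / 2\<close>.\<close>
    define \<rho> where "\<rho> = \<epsilon> / (2 * K)"
    have \<rho>: "0 < \<rho>"
      using \<epsilon> K by (simp add: \<rho>_def)
    obtain d1 where d1: "0 < d1"
      "\<And>s t. s \<in> T \<Longrightarrow> t \<in> {a..b} \<Longrightarrow> dist s t < d1 \<Longrightarrow> dist (f s (u t)) (f t (u t)) < \<rho>"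
      using uniform_continuity_at_compact[OF compact_Icc assms(2,4) u \<rho>] by metis
    have "uniformly_continuous_on {a..b} ?u'"
      using u' by (intro compact_uniformly_continuous) auto
    then obtain d2 where d2: "0 < d2"
      "\<And>s t. s \<in> {a..b} \<Longrightarrow> t \<in> {a..b} \<Longrightarrow> dist s t < d2 \<Longrightarrow> dist (?u' s) (?u' t) < \<rho>"
      using \<rho> unfolding uniformly_continuous_on_def by metis
    have "\<forall>\<^sub>F N in sequentially. ?h N < 1" "\<forall>\<^sub>F N in sequentially. ?h N < d2"
      "\<forall>\<^sub>F N in sequentially. \<bar>c2\<bar> * ?h N < d1" "\<forall>\<^sub>F N in sequentially. ?h N * \<bar>a21\<bar> < \<rho>"
      "\<forall>\<^sub>F N in sequentially. ?\<delta> N < min 1 \<rho>"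
      using order_tendstoD(2)[OF h0] order_tendstoD(2)[OF \<delta>0, of "min 1 \<rho>"]
        order_tendstoD(2)[OF tendsto_mult_right_zero[OF h0, of "\<bar>c2\<bar>"] d1(1)]
        order_tendstoD(2)[OF tendsto_mult_left_zero[OF h0, of "\<bar>a21\<bar>"] \<rho>] d2(1) \<rho>
      by auto
    then have "\<forall>\<^sub>F N in sequentially. norm (?v N N - u b) < \<epsilon>"
      using eventually_gt_at_top[of 0]
    proof eventually_elim
      case (elim N)
      define h where "h = ?h N"
      have h: "0 < h" and Nh: "real N * h = b - a"
        using elim assms(1) by (auto simp: h_def)
      have \<delta>1: "?\<delta> N < 1" "?\<delta> N < \<rho>"
        using elim(5) by auto
      have grid: "a + real n * h \<in> {a..b}" if "n \<le> N" for n
      proof -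
        have "real n * h \<le> real N * h"
          using that h by simp
        with h Nh show ?thesis
          by simp
      qed
      define E where "E n = \<bar>?v N n - u (a + real n * h)\<bar>" for n
      have step: "E (Suc n) \<le> (1 + h * C) * E n + h * (A * \<rho>)" if n: "n < N" for n
      proof -
        define t where "t = a + real n * h"
        define v where "v = ?v N n"
        have tS: "a + real (Suc n) * h = t + h"
          by (simp add: t_def algebra_simps)
        have t: "t \<in> {a..b}" "t + h \<in> {a..b}"
          using grid[of n] grid[of "Suc n"] n tS by (auto simp: t_def)
        have tT: "t \<in> T" "t + c2 * h \<in> T"
          using t assms(2) assms(3)[OF n] by (auto simp: t_def h_def)
        have "(u has_derivative (\<lambda>y. ?u' x * y)) (at x within {t..t + h})"
          if "t \<le> x" "x \<le> t + h" for x
          using DERIV_subset[OF assms(6)[of x], of "{t..t + h}"] that t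
          by (auto simp: has_field_derivative_def)
        then obtain \<xi> where \<xi>: "t < \<xi>" "\<xi> < t + h" "u (t + h) - u t = h * ?u' \<xi>"
          using mvt_simple[of t "t + h" u "\<lambda>x y. ?u' x * y"] h by (auto simp: mult.commute)
        have "\<bar>?u' \<xi> - ?u' t\<bar> < \<rho>"
          using d2(2)[of \<xi> t] \<xi> t elim(2) by (auto simp: dist_real_def h_def)
        then have "\<bar>h * (?u' \<xi> - ?u' t)\<bar> \<le> h * \<rho>"
          using h by (simp add: abs_mult)
        then have euler: "\<bar>u (t + h) - (u t + h * ?u' t)\<bar> \<le> h * \<rho>"
          using \<xi>(3) by (simp add: right_diff_distrib diff_diff_eq[symmetric])
        have "\<bar>eps2 N n * (a21 * h)\<^sup>2\<bar> \<le> B * (a21 * h)\<^sup>2"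
          using B[OF n] by (auto simp: abs_mult intro!: mult_right_mono)
        then have \<delta>: "\<bar>exp (- (eps2 N n * (a21 * h)\<^sup>2)) - 1\<bar> \<le> ?\<delta> N"
          unfolding h_def by (intro abs_exp_minus_one_le) simp
        have "\<bar>f (t + c2 * h) (u t) - ?u' t\<bar> \<le> \<rho>"
          using d1(2)[OF tT(2) t(1)] elim(3)[folded h_def] h by (simp add: dist_real_def abs_mult)
        then have "\<bar>rbf_rk2_step f a21 b1 b2 c2 h (eps2 N n) t v - (u t + h * ?u' t)\<bar>
          \<le> (1 + h * C) * \<bar>v - u t\<bar> + h * (\<bar>b2\<bar> * (\<rho> + L * (?\<delta> N + h * \<bar>a21\<bar>) * M))"
          unfolding C_def using L h elim(1)[folded h_def] assms(8) M[OF t(1)] \<delta> \<delta>1(1) lip tT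
          by (intro rbf_rk2_step_error) auto
        also have "\<dots> \<le> (1 + h * C) * \<bar>v - u t\<bar> + h * (\<bar>b2\<bar> * (\<rho> + L * (\<rho> + \<rho>) * M))"
          using \<delta>1(2) elim(4)[folded h_def] L M0 h
          by (intro add_left_mono mult_left_mono mult_right_mono add_mono) auto
        finally have "\<bar>rbf_rk2_step f a21 b1 b2 c2 h (eps2 N n) t v - u (t + h)\<bar>
          \<le> (1 + h * C) * \<bar>v - u t\<bar> + h * (\<bar>b2\<bar> * (\<rho> + L * (\<rho> + \<rho>) * M)) + h * \<rho>"
          using euler by linarith
        also have "\<dots> = (1 + h * C) * \<bar>v - u t\<bar> + h * (A * \<rho>)"
          by (simp add: A_def algebra_simps)
        finally show ?thesis
          unfolding E_def tS by (simp add: v_def t_def h_def)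
      qed
      have "E N \<le> exp (C * (real N * h)) * (real N * h) * (A * \<rho>)"
        using h C A \<rho> step by (intro discrete_gronwall[of E h C _ N]) (auto simp: E_def assms(7))
      also have "\<dots> = K * \<rho>"
        by (simp add: Nh K_def)
      also have "\<dots> < \<epsilon>"
        using \<epsilon> K by (simp add: \<rho>_def)
      finally show ?case
        by (simp add: E_def Nh)
    qed
    then show "\<exists>n0. \<forall>N\<ge>n0. norm (?v N N - u b) < \<epsilon>"
      by (simp add: eventually_sequentially)
  qed
qed

end
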